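(* Let $d_1(n)$ (resp. $d_3(n)$) denote the number of positive divisors of $n$ congruent to $1$ (resp. $3$) modulo $4$. For all integers $n\ge 1$, $$\sum_{k=0}^{n}\overline{\sigma_o\mathrm{mex}}(k)\cdot\overline{\sigma_o\mathrm{mex}}(n-k)\equiv 4\bigl(n+d_1(n)-d_3(n)\bigr)\pmod 8.$$ In particular, for $n\ge1$, the sum on the left-hand side is congruent to $0$ modulo $8$ if and only if $n$ is an odd perfect square, or $n=2^a m$ where $a\ge 1$ and $m$ is an odd non-square positive integer.
   Context: An overpartition of a nonnegative integer $n$ is a non-increasing sequence of positive integers summing to $n$ in which the first occurrence of each distinct integer may (or may not) be overlined; $\overline{\mathcal P}(n)$ denotes the set of all overpartitions of $n$ (the only overpartition of $0$ is the empty one). For an overpartition $\lambda$, $\mathrm{mex}(\lambda)$ is the least positive integer that does not occur as a part of $\lambda$, where a value counts as occurring whether it appears overlined or non-overlined. Put $\mathrm{mex}_o(\lambda)=\mathrm{mex}(\lambda)$ if $\mathrm{mex}(\lambda)$ is odd and $\mathrm{mex}_o(\lambda)=0$ otherwise. Define $\overline{\sigma_o\mathrm{mex}}(n)=\sum_{\lambda\in\overline{\mathcal P}(n)}\mathrm{mex}_o(\lambda)$ for $n\ge 0$. *)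

theory Defs
  imports "HOL-Number_Theory.Number_Theory" "HOL-Computational_Algebra.Nth_Powers"
begin

text \<open>
  A part is a pair of its size and a flag telling whether it is overlined. The last conjunct of
  the definition says that only the first occurrence of a size may be overlined.
\<close>

definition is_overpartition :: "(nat \<times> bool) list \<Rightarrow> bool" where
  "is_overpartition xs \<longleftrightarrow>
     sorted_wrt (\<ge>) (map fst xs) \<and>
     (\<forall>x\<in>set xs. fst x > 0) \<and>
     (\<forall>i j. i < j \<longrightarrow> j < length xs \<longrightarrow> fst (xs ! i) = fst (xs ! j) \<longrightarrow> \<not> snd (xs ! j))"

definition overpartitions :: "nat \<Rightarrow> (nat \<times> bool) list set" where
  "overpartitions n = {xs. is_overpartition xs \<and> sum_list (map fst xs) = n}"

definition mex :: "(nat \<times> bool) list \<Rightarrow> nat" where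
  "mex xs = (LEAST k. k > 0 \<and> k \<notin> fst ` set xs)"

definition mex_odd :: "(nat \<times> bool) list \<Rightarrow> nat" where
  "mex_odd xs = (if odd (mex xs) then mex xs else 0)"

definition sigma_mex_odd :: "nat \<Rightarrow> nat" where
  "sigma_mex_odd n = (\<Sum>xs\<in>overpartitions n. mex_odd xs)"

text \<open>The summation in \<^const>\<open>sigma_mex_odd\<close> ranges over a finite set.\<close>

lemma finite_overpartitions: "finite (overpartitions n)"
proof (rule finite_subset)
  show "overpartitions n \<subseteq> {xs. set xs \<subseteq> {..n} \<times> UNIV \<and> length xs \<le> n}"
  proof
    fix xs assume xs: "xs \<in> overpartitions n"
    then have pos: "\<forall>x\<in>set xs. fst x > 0" and s: "sum_list (map fst xs) = n"
      by (auto simp: overpartitions_def is_overpartition_def)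
    have "set xs \<subseteq> {..n} \<times> UNIV"
      using member_le_sum_list[of _ "map fst xs"] s by force
    moreover have "length ys \<le> sum_list (map fst ys)"
      if "\<forall>y\<in>set ys. fst y > 0" for ys :: "(nat \<times> bool) list"
      using that by (induction ys) auto
    ultimately show "xs \<in> {xs. set xs \<subseteq> {..n} \<times> UNIV \<and> length xs \<le> n}"
      using pos s by blast
  qed
  show "finite {xs :: (nat \<times> bool) list. set xs \<subseteq> {..n} \<times> UNIV \<and> length xs \<le> n}"
    by (rule finite_lists_length_le) simp
qed

definition divisor_count_mod4 :: "nat \<Rightarrow> nat \<Rightarrow> nat" where
  "divisor_count_mod4 r n = card {d. d dvd n \<and> [d = r] (mod 4)}"

end

theory Submission
  imports Defs
begin

text \<open>
  Why the theorem holds. Writing \<open>s\<close> for \<^const>\<open>sigma_mex_odd\<close>, the idea is that squaring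
  the power series of \<open>s\<close> modulo 8 only needs \<open>s\<close> modulo 4, and modulo 4 it is a divisor function.

  An ordinary partition can be overlined in \<open>2 ^ c\<close> ways, where \<open>c\<close> is the number of its distinct
  sizes, and the mex does not see the overlines. So modulo 4 only the partitions with one distinct
  size matter: these are \<open>d + \<dots> + d\<close> for the divisors \<open>d\<close> of \<open>n\<close>. Their mex is 2 for \<open>d = 1\<close> and
  1 otherwise, so for \<open>n > 0\<close> the number \<open>s n\<close> is \<open>2 * t n\<close> modulo 4, where \<open>t n\<close> counts the
  divisors of \<open>n\<close> other than 1 (\<open>sigma_mex_odd_cong\<close>).

  Hence, for \<open>k > 0\<close>, \<open>s k = 2 * r k\<close> with \<open>r k\<close> of the same parity as \<open>t k\<close>, while \<open>s 0 = 1\<close>.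
  The convolution is \<open>4 * (r n + (\<Sum>k\<in>{1..<n}. r k * r (n - k)))\<close>, and the terms \<open>k\<close> and \<open>n - k\<close>
  cancel modulo 2 except for \<open>k = n - k\<close>. So the factor after 4 has the parity of \<open>t n\<close> for odd \<open>n\<close>
  and of \<open>t n + t (n div 2)\<close> for even \<open>n\<close>. For odd \<open>n\<close> all divisors are odd and \<open>t n\<close> omits
  only the divisor 1. For even \<open>n\<close>, up to parity, \<open>t n + t (n div 2)\<close> counts the divisors of \<open>n\<close> that
  do not divide \<open>n div 2\<close>; their codivisors are exactly the odd divisors of \<open>n\<close>. In both cases the
  parity is that of \<open>n\<close> plus the number of odd divisors of \<open>n\<close> (\<open>nontrivial_divisor_count_cong\<close>).
  This number is \<open>d\<^sub>1(n) + d\<^sub>3(n)\<close>, which has the parity of \<open>d\<^sub>1(n) - d\<^sub>3(n)\<close>, and the congruence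
  follows.

  The odd divisors of \<open>n = 2 ^ a * m\<close> with \<open>m\<close> odd are the divisors of \<open>m\<close>, and their number is odd
  iff \<open>m\<close> is a square; this gives the criterion for divisibility by 8.
\<close>

section \<open>Parity and involutions\<close>

text \<open>
  The terms at \<open>x\<close> and \<open>f x\<close> are equal, so they cancel in pairs unless \<open>f x = x\<close>.
\<close>

lemma sum_involution_cong_fixed_points:
  fixes g :: "'a \<Rightarrow> nat"
  assumes "finite A" and "\<And>x. x \<in> A \<Longrightarrow> f x \<in> A" and "\<And>x. x \<in> A \<Longrightarrow> f (f x) = x"
    and "\<And>x. x \<in> A \<Longrightarrow> g (f x) = g x"
  shows "[sum g A = sum g {x \<in> A. f x = x}] (mod 2)"
  using assms
proof (induction A rule: finite_psubset_induct)
  case (psubset A)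
  show ?case
  proof (cases "\<exists>x\<in>A. f x \<noteq> x")
    case False
    then have "{x \<in> A. f x = x} = A" by auto
    then show ?thesis by simp
  next
    case True
    then obtain x where x: "x \<in> A" "f x \<noteq> x" by auto
    define B where "B = A - {x, f x}"
    have fx: "f x \<in> A" using x psubset.prems by auto
    have stable: "f y \<in> B" if "y \<in> B" for y
      using that psubset.prems x unfolding B_def by (metis Diff_iff insert_iff singletonD)
    have "[sum g B = sum g {y \<in> B. f y = y}] (mod 2)"
      by (rule psubset.IH) (use x stable psubset.prems in \<open>auto simp: B_def\<close>)
    moreover have "{y \<in> B. f y = y} = {y \<in> A. f y = y}"
      using x psubset.prems(2) by (auto simp: B_def)
    moreover have "sum g A = sum g B + 2 * g x"
    proof -
      have "sum g A = sum g B + sum g {x, f x}"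
        unfolding B_def using x fx psubset.hyps by (intro sum.subset_diff) auto
      also have "sum g {x, f x} = 2 * g x"
        using x psubset.prems(3) by simp
      finally show ?thesis .
    qed
    ultimately show ?thesis by (simp add: cong_def)
  qed
qed

text \<open>The involution \<open>d \<mapsto> n div d\<close> fixes only a square root of \<open>n\<close>.\<close>

lemma odd_card_divisors_iff_square:
  fixes n :: nat
  assumes "n > 0"
  shows "odd (card {d. d dvd n}) \<longleftrightarrow> is_nth_power 2 n"
proof -
  have fixed: "n div d = d \<longleftrightarrow> n = d ^ 2" if "d dvd n" for d
    using that assms by (auto elim!: dvdE simp: power2_eq_square)
  have "[(\<Sum>d\<in>{d. d dvd n}. 1::nat) = (\<Sum>d\<in>{d \<in> {d. d dvd n}. n div d = d}. 1)] (mod 2)"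
    using assms by (intro sum_involution_cong_fixed_points) (auto elim!: dvdE)
  moreover have "{d \<in> {d. d dvd n}. n div d = d} = {d. n = d ^ 2}"
    using fixed by (auto simp: power2_eq_square)
  ultimately have parity: "odd (card {d. d dvd n}) \<longleftrightarrow> odd (card {d. n = d ^ 2})"
    by (simp add: cong_def even_iff_mod_2_eq_zero)
  show ?thesis
  proof (cases "is_nth_power 2 n")
    case True
    then obtain d where d: "n = d ^ 2" by (auto simp: is_nth_power_def)
    then have "{e. n = e ^ 2} = {d}" by auto
    then show ?thesis using parity True by simp
  next
    case False
    then have "{e. n = e ^ 2} = {}" by (auto simp: is_nth_power_def)
    then show ?thesis using parity False by simp
  qed
qed

text \<open>
  Reflection \<open>k \<mapsto> n - k\<close> leaves only the middle term \<open>r (n div 2) ^ 2\<close>, which has the parity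
  of \<open>r (n div 2)\<close>.
\<close>

lemma self_convolution_cong:
  fixes r :: "nat \<Rightarrow> nat"
  shows "[(\<Sum>k\<in>{1..<n}. r k * r (n - k)) = (if even n \<and> n > 0 then r (n div 2) else 0)] (mod 2)"
proof -
  have "[(\<Sum>k\<in>{1..<n}. r k * r (n - k)) = (\<Sum>k\<in>{k \<in> {1..<n}. n - k = k}. r k * r (n - k))] (mod 2)"
    by (rule sum_involution_cong_fixed_points) auto
  also have "{k \<in> {1..<n}. n - k = k} = (if even n \<and> n > 0 then {n div 2} else {})"
    by (auto, presburger+)
  also have "[(\<Sum>k\<in>(if even n \<and> n > 0 then {n div 2} else {}). r k * r (n - k))
      = (if even n \<and> n > 0 then r (n div 2) else 0)] (mod 2)"
    by (auto elim!: evenE simp: cong_def mod_2_eq_odd)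
  finally show ?thesis .
qed

section \<open>Odd divisors\<close>

lemma finite_divisors_if_pos: "n > 0 \<Longrightarrow> finite {d. d dvd n \<and> P d}" for n :: nat
  by (rule finite_subset[OF _ finite_divisors_nat]) auto

lemma card_odd_divisors:
  fixes n :: nat
  assumes "n > 0"
  shows "card {d. d dvd n \<and> odd d} = divisor_count_mod4 1 n + divisor_count_mod4 3 n"
proof -
  have "odd d \<longleftrightarrow> [d = 1] (mod 4) \<or> [d = 3] (mod 4)" for d :: nat
    unfolding cong_def by simp presburger
  then have "{d. d dvd n \<and> odd d} = {d. d dvd n \<and> [d = 1] (mod 4)} \<union> {d. d dvd n \<and> [d = 3] (mod 4)}"
    by auto
  moreover have "{d. d dvd n \<and> [d = 1] (mod 4)} \<inter> {d. d dvd n \<and> [d = 3] (mod 4)} = {}"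
    by (auto simp: cong_def)
  ultimately show ?thesis
    using assms unfolding divisor_count_mod4_def
    by (simp add: card_Un_disjoint finite_divisors_if_pos)
qed

lemma odd_divisors_power2_mult:
  fixes m :: nat
  assumes "odd m"
  shows "{d. d dvd 2 ^ a * m \<and> odd d} = {d. d dvd m}"
proof (intro Collect_cong iffI conjI)
  fix d assume d: "d dvd 2 ^ a * m \<and> odd d"
  then have "coprime d (2 ^ a)" by simp
  then show "d dvd m" using d coprime_dvd_mult_right_iff by blast
next
  fix d assume d: "d dvd m"
  then show "d dvd 2 ^ a * m" by simp
  show "odd d" using d assms dvd_trans by blast
qed

lemma odd_card_odd_divisors_iff:
  fixes m :: nat
  assumes "odd m"
  shows "odd (card {d. d dvd 2 ^ a * m \<and> odd d}) \<longleftrightarrow> is_nth_power 2 m"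
  using odd_card_divisors_iff_square[of m] assms odd_pos[of m]
  unfolding odd_divisors_power2_mult[OF assms] by simp

text \<open>
  A divisor \<open>d\<close> of an even number \<open>n\<close> fails to divide \<open>n div 2\<close> iff its codivisor is odd.
\<close>

lemma card_divisors_not_dvd_half:
  fixes n :: nat
  assumes "even n" "n > 0"
  shows "card {d. d dvd n \<and> \<not> d dvd n div 2} = card {d. d dvd n \<and> odd d}"
proof -
  have key: "\<not> d dvd n div 2 \<longleftrightarrow> odd (n div d)" if "d dvd n" for d
  proof -
    from that obtain e where e: "n = d * e" by (auto elim: dvdE)
    obtain h where h: "n = 2 * h" using assms by (auto elim: evenE)
    have "d > 0" using e assms by auto
    moreover have "d dvd h \<longleftrightarrow> even e"
    proof -
      have "d dvd h \<longleftrightarrow> 2 * d dvd d * e" using e h by (metis nat_mult_dvd_cancel_disj zero_neq_numeral)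
      also have "\<dots> \<longleftrightarrow> even e" using \<open>d > 0\<close> by (simp add: mult.commute[of 2])
      finally show ?thesis .
    qed
    moreover have "n div 2 = h" using h by simp
    moreover have "n div d = e" using e \<open>d > 0\<close> by simp
    ultimately show ?thesis by simp
  qed
  have codivisor: "n div d dvd n" "n div (n div d) = d" if "d dvd n" for d
  proof -
    from that obtain e where e: "n = d * e" by (auto elim: dvdE)
    then show "n div d dvd n" "n div (n div d) = d" using assms by simp_all
  qed
  show ?thesis
    by (rule bij_betw_same_card[of "\<lambda>d. n div d"], rule bij_betw_byWitness[where f' = "\<lambda>d. n div d"])
       (use key codivisor in \<open>auto 0 3\<close>)
qed

definition nontrivial_divisor_count :: "nat \<Rightarrow> nat" where
  "nontrivial_divisor_count n = card {d. d dvd n \<and> d \<noteq> 1}"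

text \<open>
  For odd \<open>n\<close> the summand \<open>n\<close> on the right accounts for the missing divisor 1. For even \<open>n\<close> the
  divisors common to \<open>n\<close> and \<open>n div 2\<close> are counted twice on the left and cancel.
\<close>

lemma nontrivial_divisor_count_cong:
  assumes "n > 0"
  shows "[nontrivial_divisor_count n + (if even n then nontrivial_divisor_count (n div 2) else 0)
      = n + card {d. d dvd n \<and> odd d}] (mod 2)"
proof (cases "even n")
  case True
  then have half: "n div 2 > 0" using assms by auto
  have "{d. d dvd n \<and> d \<noteq> 1} = {d. d dvd n div 2 \<and> d \<noteq> 1} \<union> {d. d dvd n \<and> \<not> d dvd n div 2}"
    using True by (auto elim!: evenE)
  moreover have "{d. d dvd n div 2 \<and> d \<noteq> 1} \<inter> {d. d dvd n \<and> \<not> d dvd n div 2} = {}"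
    by auto
  ultimately have "nontrivial_divisor_count n
      = nontrivial_divisor_count (n div 2) + card {d. d dvd n \<and> odd d}"
    using assms half card_divisors_not_dvd_half[OF True assms]
    unfolding nontrivial_divisor_count_def
    by (simp add: card_Un_disjoint finite_divisors_if_pos)
  then show ?thesis using True by (simp add: cong_def mod_2_eq_odd)
next
  case False
  then have "{d. d dvd n \<and> odd d} = insert 1 {d. d dvd n \<and> d \<noteq> 1}"
    using dvd_trans by (auto simp: dvd_def)
  then have "card {d. d dvd n \<and> odd d} = Suc (nontrivial_divisor_count n)"
    using assms by (simp add: nontrivial_divisor_count_def finite_divisors_if_pos)
  then show ?thesis using False by (simp add: cong_def mod_2_eq_odd)
qed

section \<open>Overlining a partition\<close>

definition partitions_desc :: "nat \<Rightarrow> nat list set" where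
  "partitions_desc n = {ys. sorted_wrt (\<ge>) ys \<and> (\<forall>y\<in>set ys. y > 0) \<and> sum_list ys = n}"

definition overlinings :: "nat list \<Rightarrow> (nat \<times> bool) list set" where
  "overlinings ys = {xs. map fst xs = ys \<and> sorted_wrt (\<lambda>x z. fst x = fst z \<longrightarrow> \<not> snd z) xs}"

lemma overpartitions_conv_overlinings:
  "overpartitions n = (\<Union>ys\<in>partitions_desc n. overlinings ys)"
  unfolding overpartitions_def partitions_desc_def overlinings_def is_overpartition_def
  by (auto simp: sorted_wrt_iff_nth_less) force

text \<open>
  Once \<open>y\<close> has been met it leaves the set, so its later occurrences stay plain.
\<close>

fun overline :: "nat set \<Rightarrow> nat list \<Rightarrow> (nat \<times> bool) list" where
  "overline A [] = []"
| "overline A (y # ys) = (y, y \<in> A) # overline (A - {y}) ys"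

lemma map_fst_overline: "map fst (overline A ys) = ys"
  by (induction ys arbitrary: A) auto

lemma overlined_in_overline_iff: "(a, True) \<in> set (overline A ys) \<longleftrightarrow> a \<in> A \<and> a \<in> set ys"
  by (induction ys arbitrary: A) auto

lemma overline_in_overlinings: "overline A ys \<in> overlinings ys"
proof -
  have "sorted_wrt (\<lambda>x z. fst x = fst z \<longrightarrow> \<not> snd z) (overline A ys)"
    by (induction ys arbitrary: A) (auto simp: overlined_in_overline_iff)
  then show ?thesis by (simp add: overlinings_def map_fst_overline)
qed

lemma overline_overlined:
  assumes "sorted_wrt (\<lambda>x z. fst x = fst z \<longrightarrow> \<not> snd z) xs"
  shows "overline {a. (a, True) \<in> set xs} (map fst xs) = xs"
  using assms
proof (induction xs)
  case (Cons x xs)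
  obtain y b where x: "x = (y, b)" by (cases x)
  have "(y, True) \<notin> set xs" using Cons.prems x by auto
  then have "{a. (a, True) \<in> set (x # xs)} - {y} = {a. (a, True) \<in> set xs}"
    and "y \<in> {a. (a, True) \<in> set (x # xs)} \<longleftrightarrow> b"
    using x by auto
  then show ?case using Cons x by simp
qed simp

text \<open>An overlining is determined by the set of its overlined sizes, which can be any set of sizes.\<close>

lemma card_overlinings: "card (overlinings ys) = 2 ^ card (set ys)"
proof -
  have "bij_betw (\<lambda>xs. {a. (a, True) \<in> set xs}) (overlinings ys) (Pow (set ys))"
    by (rule bij_betw_byWitness[where f' = "\<lambda>A. overline A ys"])
       (use overline_in_overlinings in \<open>force simp: overlined_in_overline_iff overlinings_def
          overline_overlined\<close>)+
  then show ?thesis by (simp add: bij_betw_same_card card_Pow)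
qed

section \<open>The sum of odd mex values modulo 4\<close>

text \<open>
  The mex reads only the sizes, so a partition without flags has one too; the flag
  \<^const>\<open>False\<close> is an arbitrary choice.
\<close>

definition mex_odd_sizes :: "nat list \<Rightarrow> nat" where
  "mex_odd_sizes ys = mex_odd (map (\<lambda>y. (y, False)) ys)"

lemma mex_odd_overlining: "xs \<in> overlinings ys \<Longrightarrow> mex_odd xs = mex_odd_sizes ys"
  unfolding overlinings_def mex_odd_sizes_def mex_odd_def mex_def by (auto simp: image_image)

lemma finite_overlinings: "finite (overlinings ys)"
  using card_overlinings[of ys] by (auto intro: card_ge_0_finite)

lemma finite_partitions_desc: "finite (partitions_desc n)"
proof (rule finite_subset)
  show "partitions_desc n \<subseteq> map fst ` overpartitions n"
  proof
    fix ys assume "ys \<in> partitions_desc n"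
    then have "overline {} ys \<in> overpartitions n"
      using overline_in_overlinings overpartitions_conv_overlinings by blast
    then show "ys \<in> map fst ` overpartitions n"
      using map_fst_overline by (metis imageI)
  qed
qed (simp add: finite_overpartitions)

lemma sigma_mex_odd_conv_partitions:
  "sigma_mex_odd n = (\<Sum>ys\<in>partitions_desc n. 2 ^ card (set ys) * mex_odd_sizes ys)"
proof -
  have "sigma_mex_odd n = (\<Sum>ys\<in>partitions_desc n. \<Sum>xs\<in>overlinings ys. mex_odd xs)"
    unfolding sigma_mex_odd_def overpartitions_conv_overlinings
  proof (rule sum.UNION_disjoint)
    show "\<forall>ys\<in>partitions_desc n. \<forall>zs\<in>partitions_desc n.
        ys \<noteq> zs \<longrightarrow> overlinings ys \<inter> overlinings zs = {}"
      by (auto simp: overlinings_def)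
  qed (simp_all add: finite_partitions_desc finite_overlinings)
  then show ?thesis by (simp add: mex_odd_overlining card_overlinings)
qed

lemma mex_odd_sizes_constant:
  assumes "set ys = {d}" "d > 0"
  shows "mex_odd_sizes ys = (if d = 1 then 0 else 1)"
proof -
  have "mex (map (\<lambda>y. (y, False)) ys) = (LEAST k. k > 0 \<and> k \<noteq> d)"
    using assms by (simp add: mex_def image_image)
  also have "\<dots> = (if d = 1 then 2 else 1)"
    by (rule Least_equality) (use assms in \<open>auto split: if_splits\<close>)
  finally have "mex (map (\<lambda>y. (y, False)) ys) = (if d = 1 then 2 else 1)" .
  then show ?thesis by (simp add: mex_odd_sizes_def mex_odd_def)
qed

lemma card_constant_partitions:
  assumes "n > 0"
  shows "card {ys \<in> partitions_desc n. \<exists>d. d \<noteq> 1 \<and> set ys = {d}} = nontrivial_divisor_count n"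
proof -
  have "bij_betw (\<lambda>d. replicate (n div d) d) {d. d dvd n \<and> d \<noteq> 1}
      {ys \<in> partitions_desc n. \<exists>d. d \<noteq> 1 \<and> set ys = {d}}"
  proof (rule bij_betw_byWitness[where f' = hd])
    have pos: "d > 0" "n div d > 0" if "d dvd n" for d
      using that assms by (auto elim!: dvdE)
    show "\<forall>d\<in>{d. d dvd n \<and> d \<noteq> 1}. hd (replicate (n div d) d) = d"
      using pos by auto
    show "(\<lambda>d. replicate (n div d) d) ` {d. d dvd n \<and> d \<noteq> 1}
        \<subseteq> {ys \<in> partitions_desc n. \<exists>d. d \<noteq> 1 \<and> set ys = {d}}"
      using pos by (auto simp: partitions_desc_def sum_list_replicate sorted_wrt_iff_nth_less)
    have const: "hd ys dvd n \<and> hd ys \<noteq> 1 \<and> replicate (n div hd ys) (hd ys) = ys"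
      if "ys \<in> {ys \<in> partitions_desc n. \<exists>d. d \<noteq> 1 \<and> set ys = {d}}" for ys
    proof -
      from that obtain d where ys: "ys \<in> partitions_desc n" "d \<noteq> 1" "set ys = {d}"
        by auto
      then have rep: "replicate (length ys) d = ys" by (intro replicate_length_same) auto
      have "hd ys = d" using ys(3) by (cases ys) auto
      moreover have "n = length ys * d"
        using ys(1) sum_list_replicate[of "length ys" d] unfolding rep
        by (simp add: partitions_desc_def)
      moreover from this have "n div d = length ys"
        using assms by simp
      ultimately show ?thesis using rep ys(2) by simp
    qed
    show "\<forall>ys\<in>{ys \<in> partitions_desc n. \<exists>d. d \<noteq> 1 \<and> set ys = {d}}.
        replicate (n div hd ys) (hd ys) = ys"
      using const by blast
    show "hd ` {ys \<in> partitions_desc n. \<exists>d. d \<noteq> 1 \<and> set ys = {d}} \<subseteq> {d. d dvd n \<and> d \<noteq> 1}"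
    proof (rule image_subsetI)
      fix ys assume "ys \<in> {ys \<in> partitions_desc n. \<exists>d. d \<noteq> 1 \<and> set ys = {d}}"
      from const[OF this] show "hd ys \<in> {d. d dvd n \<and> d \<noteq> 1}" by simp
    qed
  qed
  then show ?thesis
    by (simp add: nontrivial_divisor_count_def bij_betw_same_card)
qed

text \<open>
  A partition with at least two distinct sizes contributes a multiple of 4, and one with
  the single size \<open>d\<close> contributes \<open>2 * mex_odd_sizes\<close>, which is 0 for \<open>d = 1\<close> and 2 otherwise.
\<close>

lemma sigma_mex_odd_cong:
  assumes "n > 0"
  shows "[sigma_mex_odd n = 2 * nontrivial_divisor_count n] (mod 4)"
proof -
  let ?const = "\<lambda>ys. \<exists>d. d \<noteq> 1 \<and> set ys = {d::nat}"
  have term_cong: "[2 ^ card (set ys) * mex_odd_sizes ys = (if ?const ys then 2 else 0)] (mod 4)"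
    if ys: "ys \<in> partitions_desc n" for ys
  proof (cases "\<exists>d. set ys = {d}")
    case True
    then obtain d where d: "set ys = {d}" by auto
    then have "d > 0" using ys by (auto simp: partitions_desc_def)
    then show ?thesis using mex_odd_sizes_constant[OF d] d by simp
  next
    case False
    have "set ys \<noteq> {}" using ys assms by (auto simp: partitions_desc_def)
    then have "card (set ys) \<noteq> 0" "card (set ys) \<noteq> 1"
      using False by (auto simp: card_1_singleton_iff)
    then have "2 \<le> card (set ys)" by linarith
    then have "2 ^ 2 dvd (2::nat) ^ card (set ys)" by (rule le_imp_power_dvd)
    then show ?thesis using False by (auto simp: cong_0_iff)
  qed
  have "[sigma_mex_odd n = (\<Sum>ys\<in>partitions_desc n. if ?const ys then 2 else 0)] (mod 4)"
    unfolding sigma_mex_odd_conv_partitions by (rule cong_sum) (rule term_cong)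
  also have "(\<Sum>ys\<in>partitions_desc n. if ?const ys then 2 else 0)
      = 2 * card {ys \<in> partitions_desc n. ?const ys}"
    by (subst sum.inter_filter[symmetric]) (simp_all add: finite_partitions_desc)
  finally show ?thesis unfolding card_constant_partitions[OF assms] .
qed

lemma sigma_mex_odd_0: "sigma_mex_odd 0 = 1"
proof -
  have "partitions_desc 0 = {[]}"
    by (auto simp: partitions_desc_def) (metis list.set_intros(1) neq_Nil_conv not_less0)
  moreover have "mex [] = 1"
    unfolding mex_def by (auto intro!: Least_equality)
  ultimately show ?thesis
    by (simp add: sigma_mex_odd_conv_partitions mex_odd_sizes_def mex_odd_def)
qed

section \<open>The convolution modulo 8\<close>

lemma convolution_cong:
  assumes "n > 0"
  shows "[(\<Sum>k=0..n. sigma_mex_odd k * sigma_mex_odd (n - k))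
      = 4 * (n + card {d. d dvd n \<and> odd d})] (mod 8)"
proof -
  define r where "r k = sigma_mex_odd k div 2" for k
  let ?t = nontrivial_divisor_count
  have s: "sigma_mex_odd k = 2 * r k" if "k > 0" for k
  proof -
    have "[sigma_mex_odd k = 2 * ?t k] (mod 2)"
      by (rule cong_dvd_modulus_nat[OF sigma_mex_odd_cong[OF that]]) simp
    then show ?thesis by (simp add: r_def cong_def mod_2_eq_odd)
  qed
  have r: "[r k = ?t k] (mod 2)" if "k > 0" for k
  proof -
    have "(2 * r k) mod (2 * 2) = (2 * ?t k) mod (2 * 2)"
      using sigma_mex_odd_cong[OF that] s[OF that] by (simp add: cong_def)
    then show ?thesis unfolding cong_def mod_mult_mult1 by simp
  qed
  (* The two end terms both equal s n, because s 0 = 1. *)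
  have "{0..n} = insert 0 (insert n {1..<n})" using assms by auto
  then have "(\<Sum>k=0..n. sigma_mex_odd k * sigma_mex_odd (n - k))
      = 2 * sigma_mex_odd n + (\<Sum>k\<in>{1..<n}. sigma_mex_odd k * sigma_mex_odd (n - k))"
    using assms by (simp add: sigma_mex_odd_0)
  also have "(\<Sum>k\<in>{1..<n}. sigma_mex_odd k * sigma_mex_odd (n - k))
      = (\<Sum>k\<in>{1..<n}. 4 * (r k * r (n - k)))"
    by (rule sum.cong) (simp_all add: s)
  finally have conv: "(\<Sum>k=0..n. sigma_mex_odd k * sigma_mex_odd (n - k))
      = 4 * (r n + (\<Sum>k\<in>{1..<n}. r k * r (n - k)))"
    by (simp add: s[OF assms] sum_distrib_left distrib_left)
  have "[r n + (\<Sum>k\<in>{1..<n}. r k * r (n - k))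
      = ?t n + (if even n \<and> n > 0 then r (n div 2) else 0)] (mod 2)"
    by (rule cong_add[OF r[OF assms] self_convolution_cong])
  also have "[?t n + (if even n \<and> n > 0 then r (n div 2) else 0)
      = ?t n + (if even n then ?t (n div 2) else 0)] (mod 2)"
    using assms by (intro cong_add) (auto intro!: r elim!: evenE)
  also note nontrivial_divisor_count_cong[OF assms]
  finally have "[4 * (r n + (\<Sum>k\<in>{1..<n}. r k * r (n - k)))
      = 4 * (n + card {d. d dvd n \<and> odd d})] (mod (4 * 2))"
    by (simp only: cong_def mult_mod_right[symmetric])
  then show ?thesis unfolding conv by simp
qed

theorem theorem1p7:
  fixes n :: nat
  assumes "n \<ge> 1"
  shows "[int (\<Sum>k=0..n. sigma_mex_odd k * sigma_mex_odd (n - k))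
            = 4 * (int n + int (divisor_count_mod4 1 n) - int (divisor_count_mod4 3 n))] (mod 8)
       \<and> ([(\<Sum>k=0..n. sigma_mex_odd k * sigma_mex_odd (n - k)) = 0] (mod 8) \<longleftrightarrow>
            (odd n \<and> is_nth_power 2 n) \<or>
            (\<exists>a m. a \<ge> 1 \<and> odd m \<and> \<not> is_nth_power 2 m \<and> n = 2 ^ a * m))"
proof -
  define S where "S = (\<Sum>k=0..n. sigma_mex_odd k * sigma_mex_odd (n - k))"
  define c where "c = card {d. d dvd n \<and> odd d}"
  have pos: "n > 0" using assms by simp
  have S: "[S = 4 * (n + c)] (mod 8)"
    unfolding S_def c_def by (rule convolution_cong[OF pos])
  have c: "c = divisor_count_mod4 1 n + divisor_count_mod4 3 n"
    unfolding c_def by (rule card_odd_divisors[OF pos])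
  (* 4 x and -4 x agree modulo 8, so d_1 + d_3 may be replaced by d_1 - d_3. *)
  have "[int S = 4 * (int n + int c)] (mod 8)"
    using S unfolding cong_int_iff[symmetric] by simp
  also have "[4 * (int n + int c)
      = 4 * (int n + int (divisor_count_mod4 1 n) - int (divisor_count_mod4 3 n))] (mod 8)"
    unfolding c cong_iff_dvd_diff by simp
  finally have part1: "[int S = 4 * (int n + int (divisor_count_mod4 1 n)
      - int (divisor_count_mod4 3 n))] (mod 8)" .
  have zero_iff: "[S = 0] (mod 8) \<longleftrightarrow> even (n + c)"
  proof -
    have "[S = 0] (mod 8) \<longleftrightarrow> [4 * (n + c) = 0] (mod 8)"
      using S cong_trans cong_sym by blast
    also have "\<dots> \<longleftrightarrow> 4 * 2 dvd 4 * (n + c)"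
      by (simp add: cong_0_iff)
    also have "\<dots> \<longleftrightarrow> even (n + c)"
      unfolding nat_mult_dvd_cancel_disj by simp
    finally show ?thesis .
  qed
  have square_iff: "odd c \<longleftrightarrow> is_nth_power 2 m" if "odd m" "n = 2 ^ a * m" for a m
    using odd_card_odd_divisors_iff[OF that(1)] that(2) unfolding c_def by simp
  have "[S = 0] (mod 8) \<longleftrightarrow> (odd n \<and> is_nth_power 2 n) \<or>
      (\<exists>a m. a \<ge> 1 \<and> odd m \<and> \<not> is_nth_power 2 m \<and> n = 2 ^ a * m)"
  proof (cases "even n")
    case False
    then show ?thesis using zero_iff square_iff[of n 0] by auto
  next
    case True
    have "\<not> is_unit (2::nat)" by simp
    then obtain m where m: "n = 2 ^ multiplicity 2 n * m" "odd m"
      using multiplicity_decompose'[of n 2] pos by blast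
    then have "multiplicity 2 n \<ge> 1"
      using True by (cases "multiplicity 2 n") auto
    then have "(\<exists>a m. a \<ge> 1 \<and> odd m \<and> \<not> is_nth_power 2 m \<and> n = 2 ^ a * m) \<longleftrightarrow> even c"
      using square_iff m by blast
    then show ?thesis using zero_iff True by simp
  qed
  then show ?thesis using part1 unfolding S_def by blast
qed

end
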